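(* Let $\alpha,\beta$ be Martin-Löf random left-c.e. reals. Define $\mathcal{D}(\alpha,\beta)=\inf\{q\in\mathbb{Q}^+ : q\alpha-\beta \text{ is a left-c.e. real}\}$ and $\mathcal{D}^{\ast}(\alpha,\beta)=\sup\{q\in\mathbb{Q}^+ : q\alpha-\beta \text{ is a right-c.e. real}\}$. Then $\mathcal{D}(\alpha,\beta)=\mathcal{D}^{\ast}(\alpha,\beta)$.
   Context: A real is left-c.e. if it is the limit of a computable increasing sequence of rationals (equivalently its left Dedekind cut is c.e.), and right-c.e. if it is the limit of a computable decreasing sequence of rationals. $\mathbb{Q}^+$ denotes the positive rationals. A real is Martin-Löf random if (the binary expansion of its fractional part) is Martin-Löf random. *)

theory Defs
  imports "HOL-Analysis.Analysis"
begin

datatype recf = Zero | Succ | Proj nat | Comp recf "recf list" | Prim recf recf | Mu recf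

inductive eval :: "recf \<Rightarrow> nat list \<Rightarrow> nat \<Rightarrow> bool" where
  zero: "eval Zero xs 0"
| succ: "eval Succ (x # xs) (Suc x)"
| proj: "i < length xs \<Longrightarrow> eval (Proj i) xs (xs ! i)"
| comp: "length ys = length gs \<Longrightarrow> (\<forall>i<length gs. eval (gs ! i) xs (ys ! i))
          \<Longrightarrow> eval f ys z \<Longrightarrow> eval (Comp f gs) xs z"
| prim0: "eval g xs y \<Longrightarrow> eval (Prim g h) (0 # xs) y"
| primS: "eval (Prim g h) (n # xs) y \<Longrightarrow> eval h (n # y # xs) z
          \<Longrightarrow> eval (Prim g h) (Suc n # xs) z"
| mu: "eval f (n # xs) 0 \<Longrightarrow> (\<forall>m<n. \<exists>y. 0 < y \<and> eval f (m # xs) y)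
          \<Longrightarrow> eval (Mu f) xs n"

definition computable :: "(nat \<Rightarrow> nat) \<Rightarrow> bool" where
  "computable f \<longleftrightarrow> (\<exists>c. \<forall>n. eval c [n] (f n))"

definition computable_rat_seq :: "(nat \<Rightarrow> rat) \<Rightarrow> bool" where
  "computable_rat_seq q \<longleftrightarrow> (\<exists>a b c. computable a \<and> computable b \<and> computable c \<and>
      (\<forall>n. q n = (of_nat (a n) - of_nat (b n)) / of_nat (c n)))"

definition left_ce :: "real \<Rightarrow> bool" where
  "left_ce x \<longleftrightarrow> (\<exists>q. computable_rat_seq q \<and> incseq (\<lambda>n. real_of_rat (q n)) \<and>
      (\<lambda>n. real_of_rat (q n)) \<longlonglongrightarrow> x)"

definition right_ce :: "real \<Rightarrow> bool" where
  "right_ce x \<longleftrightarrow> (\<exists>q. computable_rat_seq q \<and> decseq (\<lambda>n. real_of_rat (q n)) \<and>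
      (\<lambda>n. real_of_rat (q n)) \<longlonglongrightarrow> x)"

text \<open>A binary string w of length k is identified with the number m < 2^k it denotes;
  its cylinder (within [0,1)) is the dyadic interval [m/2^k, (m+1)/2^k).
  A c.e. sequence of sets of strings U_0, U_1, ... is given by a computable enumeration
  j |-> (idx j, len j, num j) of triples; triples with num j >= 2^(len j) are padding
  (this allows empty sets).\<close>

definition dyadic_cyl :: "nat \<Rightarrow> nat \<Rightarrow> real set" where
  "dyadic_cyl k m = {real m / 2 ^ k ..< (real m + 1) / 2 ^ k}"

definition test_level :: "(nat \<Rightarrow> nat) \<Rightarrow> (nat \<Rightarrow> nat) \<Rightarrow> (nat \<Rightarrow> nat) \<Rightarrow> nat \<Rightarrow> real set" where
  "test_level idx len num i =
     (\<Union>j\<in>{j. idx j = i \<and> num j < 2 ^ len j}. dyadic_cyl (len j) (num j))"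

definition mloef_test :: "(nat \<Rightarrow> nat) \<Rightarrow> (nat \<Rightarrow> nat) \<Rightarrow> (nat \<Rightarrow> nat) \<Rightarrow> bool" where
  "mloef_test idx len num \<longleftrightarrow> computable idx \<and> computable len \<and> computable num \<and>
     (\<forall>i. emeasure lborel (test_level idx len num i) \<le> ennreal ((1/2) ^ i))"

definition mloef_random :: "real \<Rightarrow> bool" where
  "mloef_random x \<longleftrightarrow>
     \<not> (\<exists>idx len num. mloef_test idx len num \<and> (\<forall>i. frac x \<in> test_level idx len num i))"

definition D_up :: "real \<Rightarrow> real \<Rightarrow> ereal" where
  "D_up \<alpha> \<beta> = Inf ((\<lambda>q. ereal (real_of_rat q)) `
      {q::rat. 0 < q \<and> left_ce (real_of_rat q * \<alpha> - \<beta>)})"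

definition D_low :: "real \<Rightarrow> real \<Rightarrow> ereal" where
  "D_low \<alpha> \<beta> = Sup ((\<lambda>q. ereal (real_of_rat q)) `
      {q::rat. 0 < q \<and> right_ce (real_of_rat q * \<alpha> - \<beta>)})"

end

theory Submission
  imports Defs "HOL-Library.Nat_Bijection"
begin

text \<open>
  A queue follows an increasing approximation \<open>s\<close> of a real and is prolonged, at stage \<open>u\<close>, by
  \<open>w u\<close> beyond its own end or beyond \<open>s (u + 1)\<close>, whichever is larger. The newly added intervals
  have total length \<open>\<Sum>u. w u\<close> and cover the limit of \<open>s\<close> as soon as the queue overtakes it, so the
  queues of a uniform family with total lengths \<open>O(2\<^sup>-\<^sup>n)\<close> cannot all overtake a random real.

  Feeding the queue of \<open>\<beta>\<close> with the increments of \<open>\<alpha>\<close>, scaled by \<open>2\<^sup>-\<^sup>n\<close>, shows that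
  \<open>\<epsilon> * \<alpha> - \<beta>\<close> is right-c.e. for some \<open>\<epsilon> > 0\<close>. If \<open>p < q\<close>, \<open>p * \<alpha> - \<beta>\<close> is not right-c.e. and \<open>q * \<alpha> - \<beta>\<close> is not left-c.e.,
  then \<open>\<beta> - \<beta>\<^sub>s < p * (\<alpha> - \<alpha>\<^sub>s)\<close> and \<open>\<beta> - \<beta>\<^sub>s > q * (\<alpha> - \<alpha>\<^sub>s)\<close> both hold for infinitely many \<open>s\<close>.
  A cover of \<open>\<alpha>\<close> of measure \<open>l\<close> then yields a cover of \<open>\<beta>\<close> of measure \<open>p * l\<close>, which in turn yields a
  cover of \<open>\<alpha>\<close> of measure \<open>p / q * l\<close>; iterating contradicts randomness. Finally, if \<open>q * \<alpha> - \<beta>\<close> is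
  left-c.e. and \<open>q' * \<alpha> - \<beta>\<close> is right-c.e. with \<open>q < q'\<close>, then \<open>\<alpha>\<close> is
  computable, which a random real is not.
\<close>

section \<open>Closure properties of computable functions\<close>

text \<open>Arguments come as one list, as in \<open>eval\<close>, so that composition, recursion
  and minimisation are each handled once for all arities; only lists of length \<open>k\<close> are
  constrained.\<close>

definition computes :: "nat \<Rightarrow> (nat list \<Rightarrow> nat) \<Rightarrow> bool" where
  "computes k f \<longleftrightarrow> (\<exists>c. \<forall>xs. length xs = k \<longrightarrow> eval c xs (f xs))"

lemma computable_iff_computes: "computable f \<longleftrightarrow> computes 1 (\<lambda>xs. f (xs ! 0))"
proof -
  have "(\<forall>xs. length xs = 1 \<longrightarrow> eval c xs (f (xs ! 0))) \<longleftrightarrow> (\<forall>n. eval c [n] (f n))" for c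
    by (auto simp: length_Suc_conv)
  then show ?thesis
    unfolding computable_def computes_def by simp
qed

lemma computes_cong:
  "(\<And>xs. length xs = k \<Longrightarrow> f xs = g xs) \<Longrightarrow> computes k f \<Longrightarrow> computes k g"
  unfolding computes_def by metis

lemma computes_comp:
  assumes f: "computes (length gs) f" and gs: "\<And>g. g \<in> set gs \<Longrightarrow> computes k g"
  shows "computes k (\<lambda>xs. f (map (\<lambda>g. g xs) gs))"
proof -
  obtain F where F: "\<And>ys. length ys = length gs \<Longrightarrow> eval F ys (f ys)"
    using f unfolding computes_def by blast
  obtain C where C: "\<And>g xs. g \<in> set gs \<Longrightarrow> length xs = k \<Longrightarrow> eval (C g) xs (g xs)"
    using gs unfolding computes_def by metis
  have "eval (Comp F (map C gs)) xs (f (map (\<lambda>g. g xs) gs))" if "length xs = k" for xs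
    by (rule eval.comp[where ys = "map (\<lambda>g. g xs) gs"]) (auto intro: F C that)
  then show ?thesis
    unfolding computes_def by blast
qed

lemma computes_proj: "i < k \<Longrightarrow> computes k (\<lambda>xs. xs ! i)"
  unfolding computes_def by (metis eval.proj)

lemma computes_Suc: "computes k g \<Longrightarrow> computes k (\<lambda>xs. Suc (g xs))"
proof -
  have "computes 1 (\<lambda>xs. Suc (hd xs))"
    unfolding computes_def by (auto intro!: exI[of _ Succ] simp: length_Suc_conv eval.succ)
  then show "computes k g \<Longrightarrow> ?thesis"
    using computes_comp[of "[g]" "\<lambda>xs. Suc (hd xs)" k] by simp
qed

lemma computes_const: "computes k (\<lambda>_. n)"
proof (induction n)
  case 0
  show ?case unfolding computes_def using eval.zero by blast
next
  case (Suc n)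
  then show ?case by (rule computes_Suc)
qed

lemma computes_prim:
  assumes "computes k g" "computes (Suc (Suc k)) h"
  shows "computes (Suc k) (\<lambda>xs. rec_nat (g (tl xs)) (\<lambda>n y. h (n # y # tl xs)) (xs ! 0))"
proof -
  obtain G H where G: "\<And>xs. length xs = k \<Longrightarrow> eval G xs (g xs)"
    and H: "\<And>xs. length xs = Suc (Suc k) \<Longrightarrow> eval H xs (h xs)"
    using assms unfolding computes_def by blast
  have "eval (Prim G H) (n # xs) (rec_nat (g xs) (\<lambda>n y. h (n # y # xs)) n)"
    if "length xs = k" for n xs
    using that by (induction n) (auto intro!: eval.prim0 eval.primS G H)
  then show ?thesis
    unfolding computes_def by (auto intro!: exI[of _ "Prim G H"] simp: length_Suc_conv)
qed

lemma computes_Least: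
  assumes "computes (Suc k) f" and ex: "\<And>xs. length xs = k \<Longrightarrow> \<exists>n. f (n # xs) = 0"
  shows "computes k (\<lambda>xs. LEAST n. f (n # xs) = 0)"
proof -
  obtain F where F: "\<And>xs. length xs = Suc k \<Longrightarrow> eval F xs (f xs)"
    using assms(1) unfolding computes_def by blast
  have "eval (Mu F) xs (LEAST n. f (n # xs) = 0)" if "length xs = k" for xs
  proof (rule eval.mu)
    show "eval F ((LEAST n. f (n # xs) = 0) # xs) 0"
      using F[of "(LEAST n. f (n # xs) = 0) # xs"] LeastI_ex[OF ex[OF that]] that by simp
    show "\<forall>m<LEAST n. f (n # xs) = 0. \<exists>y>0. eval F (m # xs) y"
    proof (intro allI impI)
      fix m assume "m < (LEAST n. f (n # xs) = 0)"
      then have "f (m # xs) \<noteq> 0" by (rule not_less_Least)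
      moreover have "eval F (m # xs) (f (m # xs))" using F that by simp
      ultimately show "\<exists>y>0. eval F (m # xs) y" by blast
    qed
  qed
  then show ?thesis
    unfolding computes_def by blast
qed

abbreviation computes2 :: "(nat \<Rightarrow> nat \<Rightarrow> nat) \<Rightarrow> bool" where
  "computes2 f \<equiv> computes 2 (\<lambda>xs. f (xs ! 0) (xs ! 1))"

lemma computes_comp1: "computable f \<Longrightarrow> computes k g \<Longrightarrow> computes k (\<lambda>xs. f (g xs))"
  using computes_comp[of "[g]" "\<lambda>xs. f (xs ! 0)" k] by (simp add: computable_iff_computes)

lemma computes_comp2:
  "computes2 f \<Longrightarrow> computes k g \<Longrightarrow> computes k h \<Longrightarrow> computes k (\<lambda>xs. f (g xs) (h xs))"
  using computes_comp[of "[g, h]" "\<lambda>xs. f (xs ! 0) (xs ! 1)" k] by (auto simp: numeral_2_eq_2)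

lemma computable_comp: "computable f \<Longrightarrow> computable g \<Longrightarrow> computable (\<lambda>x. f (g x))"
  unfolding computable_iff_computes[of g] computable_iff_computes[of "\<lambda>x. f (g x)"]
  by (rule computes_comp1)

lemma computable_comp2:
  "computes2 f \<Longrightarrow> computable g \<Longrightarrow> computable h \<Longrightarrow> computable (\<lambda>x. f (g x) (h x))"
  unfolding computable_iff_computes by (rule computes_comp2)

lemma computable_id: "computable (\<lambda>x. x)"
  unfolding computable_iff_computes by (rule computes_proj) simp

lemma computable_const: "computable (\<lambda>_. n)"
  unfolding computable_iff_computes by (rule computes_const)

lemma computable_Suc: "computable f \<Longrightarrow> computable (\<lambda>x. Suc (f x))"
  unfolding computable_iff_computes by (rule computes_Suc)

lemma computes2_rec:
  assumes "computable b" "computes 3 (\<lambda>xs. h (xs ! 0) (xs ! 1) (xs ! 2))"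
  shows "computes2 (\<lambda>n x. rec_nat (b x) (\<lambda>i y. h i y x) n)"
proof -
  have "computes (Suc 1) (\<lambda>xs. rec_nat (b (tl xs ! 0))
      (\<lambda>i y. h ((i # y # tl xs) ! 0) ((i # y # tl xs) ! 1) ((i # y # tl xs) ! 2)) (xs ! 0))"
    using assms by (intro computes_prim) (simp_all add: computable_iff_computes numeral_3_eq_3)
  then have "computes 2 (\<lambda>xs. rec_nat (b (tl xs ! 0)) (\<lambda>i y. h i y (tl xs ! 0)) (xs ! 0))"
    by (simp add: numeral_2_eq_2)
  then show ?thesis
    by (rule computes_cong[rotated]) (simp add: nth_tl)
qed

lemma computes2_add: "computes2 (+)"
proof -
  have "computes2 (\<lambda>n x. rec_nat x (\<lambda>i y. Suc y) n)"
    by (intro computes2_rec computable_id computes_Suc computes_proj) simp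
  moreover have "rec_nat x (\<lambda>i y. Suc y) n = n + x" for n x :: nat
    by (induction n) auto
  ultimately show ?thesis by simp
qed

lemma computes2_mult: "computes2 (*)"
proof -
  have "computes2 (\<lambda>n x. rec_nat 0 (\<lambda>i y. y + x) n)"
    by (intro computes2_rec computable_const computes_comp2[OF computes2_add] computes_proj) simp_all
  moreover have "rec_nat 0 (\<lambda>i y. y + x) n = n * x" for n x :: nat
    by (induction n) auto
  ultimately show ?thesis by simp
qed

lemma computable_pred: "computable (\<lambda>x. x - 1)"
proof -
  have "computes2 (\<lambda>n x. rec_nat 0 (\<lambda>i y. i) n)"
    by (intro computes2_rec computable_const computes_proj) simp
  then have "computable (\<lambda>x. rec_nat 0 (\<lambda>i y. i) x)"
    by (rule computable_comp2[OF _ computable_id computable_id])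
  moreover have "rec_nat 0 (\<lambda>i y. i) n = n - 1" for n :: nat
    by (cases n) auto
  ultimately show ?thesis by simp
qed

lemma computes2_diff: "computes2 (-)"
proof -
  have "computes2 (\<lambda>n x. rec_nat x (\<lambda>i y. y - 1) n)"
    by (intro computes2_rec computable_id computes_comp1[OF computable_pred] computes_proj) simp
  moreover have "rec_nat x (\<lambda>i y. y - 1) n = x - n" for n x :: nat
    by (induction n) auto
  ultimately have *: "computes2 (\<lambda>n x. x - n)" by simp
  show ?thesis
    by (rule computes_comp2[OF *]) (simp_all add: computes_proj)
qed

lemmas computable_add = computable_comp2[OF computes2_add]
lemmas computable_mult = computable_comp2[OF computes2_mult]
lemmas computable_diff = computable_comp2[OF computes2_diff]

lemma computable_triangle: "computable triangle"
proof -
  have "computes2 (\<lambda>n x. rec_nat 0 (\<lambda>i y. y + Suc i) n)"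
    by (intro computes2_rec computable_const computes_comp2[OF computes2_add] computes_Suc
        computes_proj) simp_all
  then have "computable (\<lambda>x. rec_nat 0 (\<lambda>i y. y + Suc i) x)"
    by (rule computable_comp2[OF _ computable_id computable_id])
  moreover have "rec_nat 0 (\<lambda>i y. y + Suc i) n = triangle n" for n
    by (induction n) auto
  ultimately show ?thesis by simp
qed

section \<open>Pairing, its projections, and recursion and case distinction for unary
  functions\<close>

abbreviation pair :: "nat \<Rightarrow> nat \<Rightarrow> nat" where
  "pair x y \<equiv> prod_encode (x, y)"

abbreviation p1 :: "nat \<Rightarrow> nat" where
  "p1 z \<equiv> fst (prod_decode z)"

abbreviation p2 :: "nat \<Rightarrow> nat" where
  "p2 z \<equiv> snd (prod_decode z)"

lemma computes2_pair: "computes2 pair"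
  unfolding prod_encode_def split
  by (intro computes_comp2[OF computes2_add] computes_comp1[OF computable_triangle] computes_proj)
    simp_all

lemmas computable_pair = computable_comp2[OF computes2_pair]

text \<open>The codes on the antidiagonal \<open>x + y = k\<close> fill the interval from
  \<open>triangle k\<close> up to \<open>triangle (Suc k)\<close>, the right end excluded. Truncated
  subtraction turns the comparison with the right end into an equation with 0, as minimisation
  requires.\<close>

lemma p1_p2_sum: "p1 z + p2 z = (LEAST k. Suc z - triangle (Suc k) = 0)"
proof -
  obtain x y where z: "z = pair x y"
    by (metis prod.collapse prod_decode_inverse)
  have mono: "triangle (Suc k) \<le> triangle (x + y)" if "k < x + y" for k
    using that unfolding triangle_def
    by (intro div_le_mono mult_le_mono) auto
  have "(LEAST k. Suc z - triangle (Suc k) = 0) = x + y"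
  proof (rule Least_equality)
    show "Suc z - triangle (Suc (x + y)) = 0"
      by (simp add: z prod_encode_def)
    fix k assume *: "Suc z - triangle (Suc k) = 0"
    show "x + y \<le> k"
    proof (rule ccontr)
      assume "\<not> x + y \<le> k"
      with mono[of k] * show False by (simp add: z prod_encode_def)
    qed
  qed
  then show ?thesis by (simp add: z)
qed

lemma computable_p1_p2_sum: "computable (\<lambda>z. p1 z + p2 z)"
proof -
  have "computes 1 (\<lambda>xs. LEAST k. Suc ((k # xs) ! 1) - triangle (Suc ((k # xs) ! 0)) = 0)"
  proof (rule computes_Least)
    show "computes (Suc 1) (\<lambda>xs. Suc (xs ! 1) - triangle (Suc (xs ! 0)))"
      by (intro computes_comp2[OF computes2_diff] computes_comp1[OF computable_triangle]
          computes_Suc computes_proj) simp_all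
    fix xs :: "nat list"
    have "Suc (xs ! 0) \<le> triangle (Suc (xs ! 0))" by simp
    then show "\<exists>n. Suc ((n # xs) ! 1) - triangle (Suc ((n # xs) ! 0)) = 0"
      by (intro exI[of _ "xs ! 0"]) simp
  qed
  then show ?thesis
    unfolding p1_p2_sum computable_iff_computes by simp
qed

lemma computable_p1: "computable f \<Longrightarrow> computable (\<lambda>x. p1 (f x))"
proof -
  have eq: "z - triangle (p1 z + p2 z) = p1 z" for z
  proof -
    obtain x y where z: "z = pair x y"
      by (metis prod.collapse prod_decode_inverse)
    show ?thesis
      unfolding z prod_encode_inverse by (simp add: prod_encode_def)
  qed
  have "computable (\<lambda>z. z - triangle (p1 z + p2 z))"
    by (intro computable_diff computable_comp[OF computable_triangle] computable_id
        computable_p1_p2_sum)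
  then show "computable f \<Longrightarrow> ?thesis"
    unfolding eq by (rule computable_comp)
qed

lemma computable_p2: "computable f \<Longrightarrow> computable (\<lambda>x. p2 (f x))"
proof -
  have "computable (\<lambda>z. (p1 z + p2 z) - p1 z)"
    by (intro computable_diff computable_p1 computable_id computable_p1_p2_sum)
  then show "computable f \<Longrightarrow> ?thesis"
    unfolding add_diff_cancel_left' by (rule computable_comp)
qed

text \<open>Counter, previous value and parameter are packed as \<open>pair i (pair y x)\<close>, so
  that from here on only unary computability has to be checked.\<close>

lemma computable_rec:
  assumes "computable b" "computable (\<lambda>z. h (p1 z) (p1 (p2 z)) (p2 (p2 z)))"
    and "computable n" "computable x"
  shows "computable (\<lambda>z. rec_nat (b (x z)) (\<lambda>i y. h i y (x z)) (n z))"
proof -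
  have "computes 3 (\<lambda>xs. h (p1 (pair (xs ! 0) (pair (xs ! 1) (xs ! 2))))
      (p1 (p2 (pair (xs ! 0) (pair (xs ! 1) (xs ! 2)))))
      (p2 (p2 (pair (xs ! 0) (pair (xs ! 1) (xs ! 2))))))"
    by (intro computes_comp1[OF assms(2)] computes_comp2[OF computes2_pair] computes_proj) simp_all
  then have "computes 3 (\<lambda>xs. h (xs ! 0) (xs ! 1) (xs ! 2))" by simp
  with assms(1) have "computes2 (\<lambda>n x. rec_nat (b x) (\<lambda>i y. h i y x) n)"
    by (rule computes2_rec)
  from computable_comp2[OF this assms(3,4)] show ?thesis .
qed

lemma computable_power:
  assumes "computable f" shows "computable (\<lambda>x. n ^ f x)"
proof -
  have "computable (\<lambda>x. rec_nat 1 (\<lambda>i y. y * n) (f x))"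
    by (rule computable_rec[where b = "\<lambda>_. 1" and h = "\<lambda>_ y _. y * n", OF _ _ assms assms])
      (intro computable_const computable_mult computable_p1 computable_p2 computable_id)+
  moreover have "rec_nat 1 (\<lambda>i y. y * n) k = n ^ k" for k
    by (induction k) auto
  ultimately show ?thesis by simp
qed

lemma computable_if0:
  assumes "computable c" "computable f" "computable g"
  shows "computable (\<lambda>x. if c x = 0 then f x else g x)"
proof -
  have "computable (\<lambda>x. (1 - c x) * f x + (1 - (1 - c x)) * g x)"
    by (intro computable_add computable_mult computable_diff computable_const assms)
  moreover have "(1 - c x) * f x + (1 - (1 - c x)) * g x = (if c x = 0 then f x else g x)" for x
    by auto
  ultimately show ?thesis by simp
qed

lemma computable_if_le:
  assumes "computable a" "computable b" "computable f" "computable g"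
  shows "computable (\<lambda>x. if a x \<le> b x then f x else g x)"
  using computable_if0[OF computable_diff[OF assms(1,2)] assms(3,4)] by simp

lemma computable_if_eq:
  assumes "computable a" "computable b" "computable f" "computable g"
  shows "computable (\<lambda>x. if a x = b x then f x else g x)"
proof -
  have "computable (\<lambda>x. if a x \<le> b x then if b x \<le> a x then f x else g x else g x)"
    by (intro computable_if_le assms)
  also have "(\<lambda>x. if a x \<le> b x then if b x \<le> a x then f x else g x else g x)
      = (\<lambda>x. if a x = b x then f x else g x)"
    by (auto simp: fun_eq_iff)
  finally show ?thesis .
qed

section \<open>Computable sequences of nonnegative rationals\<close>

text \<open>The successor in the denominator makes every natural number a code, so recursions on
  codes never meet an invalid value. Signs are treated later by \<open>csig\<close>.\<close>

definition dec :: "nat \<Rightarrow> real" where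
  "dec z = real (p1 z) / real (Suc (p2 z))"

definition crat :: "(nat \<Rightarrow> real) \<Rightarrow> bool" where
  "crat f \<longleftrightarrow> (\<exists>c. computable c \<and> (\<forall>x. f x = dec (c x)))"

lemma dec_nonneg: "0 \<le> dec z"
  by (simp add: dec_def)

lemma crat_nonneg: "crat f \<Longrightarrow> 0 \<le> f x"
  unfolding crat_def using dec_nonneg by metis

lemma crat_dec: "computable c \<Longrightarrow> crat (\<lambda>x. dec (c x))"
  unfolding crat_def by blast

lemma crat_comp: "crat f \<Longrightarrow> computable g \<Longrightarrow> crat (\<lambda>x. f (g x))"
  unfolding crat_def using computable_comp by metis

lemma crat_divide_nat: "computable a \<Longrightarrow> computable b \<Longrightarrow> crat (\<lambda>x. real (a x) / real (b x))"
  unfolding crat_def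
  \<comment> \<open>A zero denominator is sent to a code of 0, in agreement with division by zero in
    HOL.\<close>
  by (intro exI[of _ "\<lambda>x. if b x = 0 then pair 0 0 else pair (a x) (b x - 1)"] conjI
      computable_if0 computable_pair computable_diff computable_const) (auto simp: dec_def)

lemma crat_nat: "computable a \<Longrightarrow> crat (\<lambda>x. real (a x))"
  using crat_divide_nat[of a "\<lambda>_. 1"] by (simp add: computable_const)

lemma crat_const:
  assumes "r \<in> \<rat>" "0 \<le> r" shows "crat (\<lambda>_. r)"
proof -
  obtain m n where "r = real m / real n"
    using Rats_abs_nat_div_natE[OF assms(1)] assms(2) by (metis abs_of_nonneg)
  then show ?thesis
    using crat_divide_nat[OF computable_const computable_const] by simp
qed

text \<open>With a common denominator, sums, truncated differences and comparisons become operations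
  on natural numerators.\<close>

lemma crat_common:
  assumes "crat f" "crat g"
  obtains a b d where "computable a" "computable b" "computable d" "\<And>x. 0 < d x"
    "\<And>x. f x = real (a x) / real (d x)" "\<And>x. g x = real (b x) / real (d x)"
proof -
  obtain u v where u: "computable u" "\<And>x. f x = dec (u x)" and v: "computable v" "\<And>x. g x = dec (v x)"
    using assms unfolding crat_def by metis
  show thesis
  proof (rule that)
    show "computable (\<lambda>x. p1 (u x) * Suc (p2 (v x)))" "computable (\<lambda>x. p1 (v x) * Suc (p2 (u x)))"
      "computable (\<lambda>x. Suc (p2 (u x)) * Suc (p2 (v x)))"
      by (intro computable_mult computable_Suc computable_p1 computable_p2 u v)+
  qed (simp_all add: u v dec_def del: of_nat_Suc mult_Suc mult_Suc_right)
qed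

lemma crat_add: assumes "crat f" "crat g" shows "crat (\<lambda>x. f x + g x)"
proof -
  obtain a b d where *: "computable a" "computable b" "computable d" "\<And>x. 0 < d x"
    "\<And>x. f x = real (a x) / real (d x)" "\<And>x. g x = real (b x) / real (d x)"
    using crat_common[OF assms] by metis
  have "crat (\<lambda>x. real (a x + b x) / real (d x))"
    by (intro crat_divide_nat computable_add *)
  then show ?thesis by (simp add: * add_divide_distrib)
qed

lemma crat_mult: assumes "crat f" "crat g" shows "crat (\<lambda>x. f x * g x)"
proof -
  obtain a b d where *: "computable a" "computable b" "computable d" "\<And>x. 0 < d x"
    "\<And>x. f x = real (a x) / real (d x)" "\<And>x. g x = real (b x) / real (d x)"
    using crat_common[OF assms] by metis
  have "crat (\<lambda>x. real (a x * b x) / real (d x * d x))"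
    by (intro crat_divide_nat computable_mult *)
  then show ?thesis by (simp add: *)
qed

lemma crat_monus: assumes "crat f" "crat g" shows "crat (\<lambda>x. max 0 (f x - g x))"
proof -
  obtain a b d where *: "computable a" "computable b" "computable d" "\<And>x. 0 < d x"
    "\<And>x. f x = real (a x) / real (d x)" "\<And>x. g x = real (b x) / real (d x)"
    using crat_common[OF assms] by metis
  have "crat (\<lambda>x. real (a x - b x) / real (d x))"
    by (intro crat_divide_nat computable_diff *)
  moreover have "real (a x - b x) / real (d x) = max 0 (f x - g x)" for x
    using *(4)[of x] by (cases "a x \<le> b x") (auto simp: * max_def divide_simps of_nat_diff)
  ultimately show ?thesis by simp
qed

lemma crat_diff: "crat f \<Longrightarrow> crat g \<Longrightarrow> (\<And>x. g x \<le> f x) \<Longrightarrow> crat (\<lambda>x. f x - g x)"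
  using crat_monus[of f g] by (simp add: max_def)

lemma crat_max: assumes "crat f" "crat g" shows "crat (\<lambda>x. max (f x) (g x))"
proof -
  have "crat (\<lambda>x. g x + max 0 (f x - g x))"
    by (intro crat_add crat_monus assms)
  moreover have "g x + max 0 (f x - g x) = max (f x) (g x)" for x by auto
  ultimately show ?thesis by simp
qed

lemma crat_min: assumes "crat f" "crat g" shows "crat (\<lambda>x. min (f x) (g x))"
proof -
  have "crat (\<lambda>x. max 0 (f x - max 0 (f x - g x)))"
    by (intro crat_monus assms)
  moreover have "max 0 (f x - max 0 (f x - g x)) = min (f x) (g x)" for x
    using crat_nonneg[OF assms(1), of x] crat_nonneg[OF assms(2), of x] by auto
  ultimately show ?thesis by simp
qed

lemma computable_if_crat_le:
  assumes "crat f" "crat g" "computable h" "computable k"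
  shows "computable (\<lambda>x. if f x \<le> g x then h x else k x)"
proof -
  obtain a b d where *: "computable a" "computable b" "computable d" "\<And>x. 0 < d x"
    "\<And>x. f x = real (a x) / real (d x)" "\<And>x. g x = real (b x) / real (d x)"
    using crat_common[OF assms(1,2)] by metis
  have "computable (\<lambda>x. if a x \<le> b x then h x else k x)"
    by (intro computable_if_le * assms)
  moreover have "a x \<le> b x \<longleftrightarrow> f x \<le> g x" for x
    using *(4)[of x] by (simp add: * divide_simps)
  ultimately show ?thesis by simp
qed

lemma crat_if0:
  assumes "computable c" "crat f" "crat g"
  shows "crat (\<lambda>x. if c x = 0 then f x else g x)"
proof -
  obtain u v where u: "computable u" "\<And>x. f x = dec (u x)" and v: "computable v" "\<And>x. g x = dec (v x)"
    using assms unfolding crat_def by metis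
  show ?thesis
    unfolding crat_def
    by (intro exI[of _ "\<lambda>x. if c x = 0 then u x else v x"] conjI computable_if0 assms u v)
      (simp add: u v)
qed

lemma crat_half_power: "computable f \<Longrightarrow> crat (\<lambda>x. (1/2) ^ f x)"
  using crat_divide_nat[of "\<lambda>_. 1" "\<lambda>x. 2 ^ f x"]
  by (simp add: computable_const computable_power power_one_over)

text \<open>The recursion is run on codes: \<open>H\<close> has to be computable as a function of a
  code of the previous value, and decoding every stage gives back the real recursion.\<close>

lemma crat_rec:
  assumes "crat B" and H: "crat (\<lambda>z. H (p1 z) (dec (p1 (p2 z))) (p2 (p2 z)))"
    and "computable n" "computable x"
  shows "crat (\<lambda>z. rec_nat (B (x z)) (\<lambda>i y. H i y (x z)) (n z))"
proof -
  obtain b h where b: "computable b" "\<And>x. B x = dec (b x)"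
    and h: "computable h" "\<And>z. H (p1 z) (dec (p1 (p2 z))) (p2 (p2 z)) = dec (h z)"
    using assms(1,2) unfolding crat_def by metis
  have h': "dec (h (pair i (pair y x))) = H i (dec y) x" for i y x
    using h(2)[of "pair i (pair y x)"] by simp
  have "computable (\<lambda>z. rec_nat (b (x z)) (\<lambda>i y. h (pair i (pair y (x z)))) (n z))"
    by (rule computable_rec[where h = "\<lambda>i y x. h (pair i (pair y x))"])
      (simp_all add: b h assms)
  moreover have "rec_nat (B x) (\<lambda>i y. H i y x) n
      = dec (rec_nat (b x) (\<lambda>i y. h (pair i (pair y x))) n)" for x n
    by (induction n) (simp_all add: b h')
  ultimately show ?thesis
    unfolding crat_def by blast
qed

text \<open>Initial segments \<open>f 0, \<dots>, f (k - 1)\<close> are stored as right-nested pairs, last entry first.\<close>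

primrec table :: "(nat \<Rightarrow> nat) \<Rightarrow> nat \<Rightarrow> nat" where
  "table f 0 = 0"
| "table f (Suc k) = pair (f k) (table f k)"

definition entry :: "nat \<Rightarrow> nat \<Rightarrow> nat \<Rightarrow> nat" where
  "entry t k i = p1 (rec_nat t (\<lambda>_ y. p2 y) (k - Suc i))"

lemma entry_table: "i < k \<Longrightarrow> entry (table f k) k i = f i"
proof -
  have *: "rec_nat (table f (j + d)) (\<lambda>_ y. p2 y) d = table f j" for j d
  proof (induction d arbitrary: j)
    case (Suc d)
    show ?case using Suc.IH[of "Suc j"] by simp
  qed simp
  assume "i < k"
  then show ?thesis
    using *[of "Suc i" "k - Suc i"] by (simp add: entry_def)
qed

lemma computable_entry:
  assumes "computable t" "computable k" "computable i"
  shows "computable (\<lambda>x. entry (t x) (k x) (i x))"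
  unfolding entry_def
  by (intro computable_p1 computable_rec[where b = "\<lambda>t. t" and h = "\<lambda>_ y _. p2 y"]
      computable_p2 computable_diff computable_Suc computable_id assms)

lemma table_eq_rec: "table f k = rec_nat 0 (\<lambda>i y. pair (f i) y) k"
  by (induction k) auto

text \<open>The recursion runs in both \<open>m\<close> and \<open>u\<close>. Since level
  \<open>m\<close> looks only at levels \<open>m\<close> and \<open>m - 1\<close>, the table of all
  levels below a fixed bound determines its own successor, and a single primitive recursion on
  \<open>u\<close> over such tables suffices.\<close>

lemma computable_levels:
  fixes F :: "nat \<Rightarrow> nat \<Rightarrow> nat"
  assumes F: "\<And>m u. F m (Suc u) = h m u (F m u) (F (m - 1) u)"
    and h: "computable (\<lambda>z. h (p1 z) (p1 (p2 z)) (p1 (p2 (p2 z))) (p2 (p2 (p2 z))))"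
    and F0: "computable (\<lambda>m. F m 0)"
    and "computable m" "computable u"
  shows "computable (\<lambda>x. F (m x) (u x))"
proof -
  have h': "computable (\<lambda>z. h (a z) (b z) (c z) (d z))"
    if "computable a" "computable b" "computable c" "computable d" for a b c d
    using computable_comp[OF h computable_pair[OF that(1) computable_pair[OF that(2)
          computable_pair[OF that(3,4)]]]] by simp
  define T where "T k u = table (\<lambda>m. F m u) k" for k u
  define step where
    "step i t k = table (\<lambda>m. h m i (entry t k m) (entry t k (m - 1))) k" for i t k
  have T: "T k u = rec_nat (table (\<lambda>m. F m 0) k) (\<lambda>i t. step i t k) u" for k u
  proof (induction u)
    case (Suc u)
    have cong: "table f j = table g j" if "\<And>i. i < j \<Longrightarrow> f i = g i" for f g j
      using that by (induction j) auto
    have "T k (Suc u) = step u (T k u) k"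
      unfolding T_def step_def by (rule cong) (simp add: F entry_table)
    then show ?case by (simp add: Suc)
  qed (simp add: T_def)
  have tab: "computable (\<lambda>z. table (f (x z)) (n z))"
    if "computable (\<lambda>z. f (p2 z) (p1 z))" "computable x" "computable n" for f x n
    unfolding table_eq_rec
  proof (intro computable_rec[where b = "\<lambda>_. 0" and h = "\<lambda>i y x. pair (f x i) y"]
      computable_const computable_pair computable_p1 computable_p2 computable_id that)
    show "computable (\<lambda>z. f (p2 (p2 z)) (p1 z))"
      using computable_comp[OF that(1) computable_pair[OF computable_p1[OF computable_id]
            computable_p2[OF computable_p2[OF computable_id]]]] by simp
  qed
  have "computable (\<lambda>z. step (p1 z) (p1 (p2 z)) (p2 (p2 z)))"
    unfolding step_def
    by (rule tab[where f = "\<lambda>z m. h m (p1 z) (entry (p1 (p2 z)) (p2 (p2 z)) m)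
          (entry (p1 (p2 z)) (p2 (p2 z)) (m - 1))" and x = "\<lambda>z. z"])
      (intro h' computable_entry computable_p1 computable_p2 computable_diff computable_const
        computable_id)+
  moreover have "computable (\<lambda>z. table (\<lambda>m. F m 0) z)"
    using tab[where f = "\<lambda>_ m. F m 0", OF _ computable_id computable_id]
      computable_comp[OF F0 computable_p1[OF computable_id]] by simp
  ultimately have "computable (\<lambda>x. T (Suc (m x)) (u x))"
    unfolding T by (intro computable_rec computable_Suc assms)
  then have "computable (\<lambda>x. entry (T (Suc (m x)) (u x)) (Suc (m x)) (m x))"
    by (intro computable_entry computable_Suc assms)
  then show ?thesis
    by (simp add: T_def entry_table del: table.simps)
qed

lemma crat_levels:
  fixes F :: "nat \<Rightarrow> nat \<Rightarrow> real"
  assumes F: "\<And>m u. F m (Suc u) = H m u (F m u) (F (m - 1) u)"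
    and H: "crat (\<lambda>z. H (p1 z) (p1 (p2 z)) (dec (p1 (p2 (p2 z)))) (dec (p2 (p2 (p2 z)))))"
    and F0: "crat (\<lambda>m. F m 0)"
    and "computable m" "computable u"
  shows "crat (\<lambda>x. F (m x) (u x))"
proof -
  obtain b h where b: "computable b" "\<And>m. F m 0 = dec (b m)"
    and h: "computable h"
      "\<And>z. H (p1 z) (p1 (p2 z)) (dec (p1 (p2 (p2 z)))) (dec (p2 (p2 (p2 z)))) = dec (h z)"
    using F0 H unfolding crat_def by metis
  have h': "H m u (dec y) (dec z) = dec (h (pair m (pair u (pair y z))))" for m u y z
    using h(2)[of "pair m (pair u (pair y z))"] by simp
  \<comment> \<open>\<open>C\<close> is a recursion on functions, which merely describes the
    intended codes; its computability comes from \<open>computable_levels\<close>, not from this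
    form.\<close>
  define C where "C m u = rec_nat b (\<lambda>u c m. h (pair m (pair u (pair (c m) (c (m - 1)))))) u m" for m u
  have C: "F m u = dec (C m u)" for m u
    by (induction u arbitrary: m) (simp_all add: C_def b F h')
  have "computable (\<lambda>x. C (m x) (u x))"
    by (rule computable_levels[where h = "\<lambda>m u y z. h (pair m (pair u (pair y z)))"])
      (simp_all add: C_def b h assms)
  then show ?thesis
    unfolding C by (rule crat_dec)
qed

section \<open>Queues\<close>

primrec queue :: "(nat \<Rightarrow> real) \<Rightarrow> (nat \<Rightarrow> real) \<Rightarrow> nat \<Rightarrow> real" where
  "queue s w 0 = s 0"
| "queue s w (Suc u) = max (queue s w u) (s (Suc u)) + w u"

lemma queue_ge:
  assumes "\<And>u. 0 \<le> w u" "t \<le> u"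
  shows "s t + (\<Sum>v=t..<u. w v) \<le> queue s w u"
  using assms(2)
proof (induction u rule: dec_induct)
  case base
  \<comment> \<open>For positive \<open>t\<close> the last extension already started at
    \<open>s t\<close> or beyond, and \<open>w (t - 1)\<close> is nonnegative.\<close>
  show ?case using assms(1)[of "t - 1"] by (cases t) auto
next
  case (step u)
  then show ?case by auto
qed

lemma mono_queue: "(\<And>u. 0 \<le> w u) \<Longrightarrow> mono (queue s w)"
  unfolding mono_iff_le_Suc by (auto simp: add_increasing2 le_max_iff_disj)

text \<open>This is the length of the part of the interval from \<open>s u\<close> to
  \<open>s (Suc u)\<close> that lies below the end \<open>E u\<close>, that is, the movement of
  \<open>s\<close> already anticipated at stage \<open>u\<close>.\<close>

definition covered :: "(nat \<Rightarrow> real) \<Rightarrow> (nat \<Rightarrow> real) \<Rightarrow> nat \<Rightarrow> real" where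
  "covered s E u = max 0 (min (s (Suc u)) (E u) - s u)"

lemma covered_nonneg: "0 \<le> covered s E u"
  by (simp add: covered_def)

text \<open>Conservation law: the weights spent so far equal the covered movement plus the reserve
  \<open>queue s w U - s U\<close>, and the reserve is never negative.\<close>

lemma sum_covered_queue:
  assumes "incseq s" "\<And>u. 0 \<le> w u"
  shows "(\<Sum>u<U. covered s (queue s w) u) \<le> (\<Sum>u<U. w u)"
proof -
  have ge: "s u \<le> queue s w u" for u
    using queue_ge[OF assms(2), of u u s] by simp
  have "(\<Sum>u<U. covered s (queue s w) u) + (queue s w U - s U) = (\<Sum>u<U. w u)"
  proof (induction U)
    case (Suc U)
    have "covered s (queue s w) U + (queue s w (Suc U) - s (Suc U)) = queue s w U - s U + w U"
      using incseq_SucD[OF assms(1), of U] ge[of U] by (simp add: covered_def)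
    with Suc show ?case by simp
  qed simp
  with ge[of U] show ?thesis by linarith
qed

text \<open>If every queue overtook \<open>frac x\<close>, the intervals added to the queues would
  form a Martin-Loef test. At the step where a queue first overtakes, both its old end and the
  current value of \<open>s\<close> are at most \<open>frac x\<close>, so the added interval
  contains \<open>frac x\<close>.\<close>

lemma random_queue_bounded:
  assumes x: "mloef_random x" and s: "crat s" "incseq s" "s \<longlonglongrightarrow> frac x"
    and W: "crat (\<lambda>z. W (p1 z) (p2 z))" and K: "\<And>n U. (\<Sum>u<U. W n u) \<le> K * (1/2) ^ n"
  shows "\<exists>n. \<forall>u. queue s (W n) u \<le> frac x"
proof (rule ccontr)
  assume "\<not> ?thesis"
  then have exceeds: "\<exists>u. frac x < queue s (W n) u" for n
    by (meson not_le)
  \<comment> \<open>Level \<open>i\<close> of the test will use queue \<open>i + k0\<close>: the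
    shift absorbs \<open>K\<close> and leaves half of the allowed measure for rounding to dyadic
    intervals.\<close>
  obtain k0 where "2 * K < 2 ^ k0"
    using real_arch_pow[of 2 "2 * K"] by auto
  then have k0: "K * (1/2) ^ k0 \<le> 1/2"
    by (simp add: power_one_over field_simps)
  have W0: "0 \<le> W n u" for n u
    using crat_nonneg[OF W, of "pair n u"] by simp
  have W': "crat (\<lambda>z. W (f z) (g z))" if "computable f" "computable g" for f g
    using crat_comp[OF W computable_pair[OF that]] by simp
  note c = computable_p1 computable_p2 computable_id computable_add computable_const computable_Suc
    computable_power
  have E: "crat (\<lambda>z. queue s (W (f z)) (g z))" if "computable f" "computable g" for f g
  proof -
    have "queue s (W n) u = rec_nat (s 0) (\<lambda>u y. max y (s (Suc u)) + W n u) u" for n u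
      by (induction u) auto
    moreover have "crat (\<lambda>z. rec_nat (s 0) (\<lambda>u y. max y (s (Suc u)) + W (f z) u) (g z))"
      by (rule crat_rec[where B = "\<lambda>_. s 0" and H = "\<lambda>u y n. max y (s (Suc u)) + W n u"])
        (intro crat_comp[OF s(1)] crat_add crat_max crat_dec W' c that)+
    ultimately show ?thesis by simp
  qed
  \<comment> \<open>Index \<open>j\<close> codes a test level, a stage and a candidate dyadic
    numerator. The grid becomes finer with the stage, which keeps the total rounding error
    summable.\<close>
  define len where "len j = p1 j + p1 (p2 j) + 4" for j
  define lo where "lo n u = max (queue s (W n) u) (s (Suc u))" for n u
  define hi where "hi n u = queue s (W n) (Suc u)" for n u
  \<comment> \<open>Cylinders not meeting the closed interval from \<open>lo\<close> to
    \<open>hi\<close> are replaced by the padding value \<open>2 ^ len j\<close>.\<close>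
  define num where "num j = (if real (p2 (p2 j)) / real (2 ^ len j) \<le> hi (p1 j + k0) (p1 (p2 j))
      then if lo (p1 j + k0) (p1 (p2 j)) \<le> real (Suc (p2 (p2 j))) / real (2 ^ len j)
        then p2 (p2 j) else 2 ^ len j else 2 ^ len j)" for j
  have hi: "hi n u = lo n u + W n u" for n u
    by (simp add: hi_def lo_def)
  have "computable len"
    unfolding len_def by (intro c)
  moreover have "computable num"
    unfolding num_def lo_def hi_def
    by (intro computable_if_crat_le crat_divide_nat crat_max E crat_comp[OF s(1)] c \<open>computable len\<close>)
  moreover have "computable p1"
    using computable_p1[OF computable_id] .
  moreover have "emeasure lborel (test_level p1 len num i) \<le> ennreal ((1/2) ^ i)" for i
  proof -
    \<comment> \<open>\<open>d u\<close> is the mesh at stage \<open>u\<close>. A chosen cylinder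
      sticks out by at most \<open>d u\<close> on either side, and all these margins together cost
      at most a quarter of \<open>(1/2) ^ i\<close>.\<close>
    define d :: "nat \<Rightarrow> real" where "d u = (1/2) ^ (i + u + 4)" for u
    define J where "J u = {lo (i + k0) u - d u ..< hi (i + k0) u + d u}" for u
    have "dyadic_cyl (len j) (num j) \<subseteq> J (p1 (p2 j))" if "num j < 2 ^ len j" "p1 j = i" for j
    proof -
      have "num j = p2 (p2 j)" "real (num j) / 2 ^ len j \<le> hi (i + k0) (p1 (p2 j))"
        "lo (i + k0) (p1 (p2 j)) \<le> (real (num j) + 1) / 2 ^ len j"
        using that by (auto simp: num_def add.commute split: if_splits)
      moreover have "d (p1 (p2 j)) = 1 / 2 ^ len j"
        by (simp add: d_def len_def power_one_over flip: that(2))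
      ultimately show ?thesis
        by (auto simp: dyadic_cyl_def J_def add_divide_distrib)
    qed
    then have sub: "test_level p1 len num i \<subseteq> (\<Union>u. J u)"
      unfolding test_level_def by blast
    have J: "emeasure lborel (J u) = ennreal (W (i + k0) u + 2 * d u)" for u
      using W0[of "i + k0" u] by (simp add: J_def hi d_def)
    have "(\<Sum>u<U. W (i + k0) u + 2 * d u) \<le> (1/2) ^ i" for U
    proof -
      have "(\<Sum>u<U. (1/2) ^ u :: real) \<le> 2"
        by (simp add: sum_gp_strict)
      then have "(1/2) ^ i / 8 * (\<Sum>u<U. (1/2) ^ u :: real) \<le> (1/2) ^ i / 8 * 2"
        by (intro mult_left_mono) simp_all
      moreover have "(1/2) ^ i / 8 * (\<Sum>u<U. (1/2) ^ u :: real) = (\<Sum>u<U. 2 * d u)"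
        unfolding sum_distrib_left by (simp add: d_def power_add power4_eq_xxxx mult.commute)
      ultimately have "(\<Sum>u<U. 2 * d u) \<le> (1/2) ^ i / 4"
        by linarith
      moreover have "(\<Sum>u<U. W (i + k0) u) \<le> (1/2) ^ i / 2"
      proof -
        have "K * (1/2) ^ (i + k0) \<le> (1/2) ^ i * (1/2)"
          using mult_left_mono[OF k0, of "(1/2) ^ i"] by (simp add: power_add mult_ac)
        with K[of "i + k0" U] show ?thesis by simp
      qed
      moreover have "(0::real) \<le> (1/2) ^ i" by simp
      ultimately show ?thesis unfolding sum.distrib by linarith
    qed
    moreover have "0 \<le> W (i + k0) u + 2 * d u" for u
      using W0 by (simp add: d_def)
    ultimately have "(\<Sum>u. emeasure lborel (J u)) \<le> ennreal ((1/2) ^ i)"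
      unfolding J by (intro suminf_le_const summableI) (simp add: sum_ennreal ennreal_leI)
    moreover have "emeasure lborel (\<Union>u. J u) \<le> (\<Sum>u. emeasure lborel (J u))"
      by (rule emeasure_subadditive_countably) (auto simp: J_def)
    moreover have "emeasure lborel (test_level p1 len num i) \<le> emeasure lborel (\<Union>u. J u)"
      by (rule emeasure_mono[OF sub]) (auto simp: J_def)
    ultimately show ?thesis by order
  qed
  moreover have "frac x \<in> test_level p1 len num i" for i
  proof -
    let ?E = "queue s (W (i + k0))"
    define v where "v = (LEAST v. frac x < ?E v)"
    have v: "frac x < ?E v" "\<And>w. w < v \<Longrightarrow> ?E w \<le> frac x"
      using LeastI_ex[OF exceeds, of "i + k0"] not_less_Least[of _ "\<lambda>v. frac x < ?E v"]
      by (auto simp: v_def not_less)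
    have le: "s u \<le> frac x" for u
      using incseq_le[OF s(2,3)] .
    \<comment> \<open>The overtaking stage is not 0, because the queue starts at \<open>s 0\<close>,
      which is at most \<open>frac x\<close>.\<close>
    obtain u where u: "v = Suc u"
      using v(1) le[of 0] by (cases v) auto
    define l where "l = i + u + 4"
    define m where "m = nat \<lfloor>frac x * 2 ^ l\<rfloor>"
    define j where "j = pair i (pair u m)"
    have m: "real m \<le> frac x * 2 ^ l" "frac x * 2 ^ l < real m + 1"
      unfolding m_def by (simp_all add: frac_ge_0)
    have "real m < 2 ^ l"
      using m(1) frac_lt_1[of x] by (smt (verit) mult_less_cancel_right2 zero_less_power)
    then have "m < 2 ^ l"
      by (metis of_nat_less_iff of_nat_numeral of_nat_power)
    have m': "real m / 2 ^ l \<le> frac x" "frac x < (real m + 1) / 2 ^ l"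
      using m by (simp_all add: divide_simps)
    have "len j = l" by (simp add: len_def j_def l_def)
    moreover have "num j = m"
    proof -
      have "real m / real (2 ^ l) \<le> hi (i + k0) u"
        using v(1) m'(1) by (simp add: hi_def u)
      moreover have "lo (i + k0) u \<le> real (Suc m) / real (2 ^ l)"
        using v(2)[of u] le[of "Suc u"] m'(2) by (simp add: lo_def u add.commute)
      ultimately show ?thesis
        using \<open>len j = l\<close> by (simp add: num_def j_def)
    qed
    ultimately show ?thesis
      using \<open>m < 2 ^ l\<close> m' unfolding test_level_def dyadic_cyl_def
      by (intro UN_I[of j]) (auto simp: j_def)
  qed
  ultimately show False
    using x unfolding mloef_random_def mloef_test_def by blast
qed

section \<open>Consequences for increasing approximations of a random real\<close>

lemma sum_diff_le_limit:
  fixes s :: "nat \<Rightarrow> real"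
  assumes "incseq s" "s \<longlonglongrightarrow> l"
  shows "(\<Sum>u<U. s (Suc u) - s u) \<le> l - s 0"
  using incseq_le[OF assms, of U] by (simp add: sum_lessThan_telescope)

text \<open>This is the Kucera--Slaman theorem that random left-c.e. reals are Solovay complete.\<close>

lemma random_dominates:
  assumes "mloef_random x" and b: "crat b" "incseq b" "b \<longlonglongrightarrow> frac x"
    and a: "crat a" "incseq a" "a \<longlonglongrightarrow> l"
  shows "\<exists>n. \<forall>t. b t - (1/2) ^ n * a t \<le> frac x - (1/2) ^ n * l"
proof -
  define W where "W n u = (1/2) ^ n * (a (Suc u) - a u)" for n u
  note c = computable_p1 computable_p2 computable_id computable_Suc
  have "crat (\<lambda>z. W (p1 z) (p2 z))"
    unfolding W_def using incseq_SucD[OF a(2)]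
    by (intro crat_mult crat_half_power crat_diff crat_comp[OF a(1)] c)
  moreover have "(\<Sum>u<U. W n u) \<le> (l - a 0) * (1/2) ^ n" for n U
    unfolding W_def sum_distrib_left[symmetric] mult.commute[of "l - a 0"]
    by (intro mult_left_mono sum_diff_le_limit a) simp
  ultimately obtain n where n: "\<And>u. queue b (W n) u \<le> frac x"
    using random_queue_bounded[OF assms(1) b, of W] by blast
  \<comment> \<open>From stage \<open>t\<close> on the queue gains all scaled increments of
    \<open>a\<close>. Its bound by \<open>frac x\<close> therefore holds for each later
    \<open>u\<close>, and \<open>u\<close> then tends to infinity.\<close>
  have "b t + (1/2) ^ n * (l - a t) \<le> frac x" for t
  proof (rule LIMSEQ_le_const2)
    show "(\<lambda>u. b t + (1/2) ^ n * (a u - a t)) \<longlonglongrightarrow> b t + (1/2) ^ n * (l - a t)"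
      by (intro tendsto_intros a)
    have "b t + (1/2) ^ n * (a u - a t) \<le> frac x" if "t \<le> u" for u
    proof -
      have "0 \<le> W n v" for v
        using incseq_SucD[OF a(2)] by (simp add: W_def)
      then have "b t + (\<Sum>v=t..<u. W n v) \<le> queue b (W n) u"
        using that by (rule queue_ge)
      moreover have "(\<Sum>v=t..<u. W n v) = (1/2) ^ n * (a u - a t)"
        unfolding W_def sum_distrib_left[symmetric] using that by (simp add: sum_Suc_diff')
      ultimately show ?thesis using n[of u] by simp
    qed
    then show "\<exists>N. \<forall>u\<ge>N. b t + (1/2) ^ n * (a u - a t) \<le> frac x"
      by blast
  qed
  then show ?thesis
    by (intro exI[of _ n]) (simp add: algebra_simps)
qed

text \<open>Queue \<open>n\<close> spends its whole budget \<open>2 * (1/2) ^ n\<close> at the first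
  stage where the error bound \<open>d\<close> drops to \<open>(1/2) ^ n\<close>. This exceeds the
  remaining distance to \<open>frac x\<close>, so every queue overtakes.\<close>

lemma random_not_computable:
  assumes "mloef_random x" and a: "crat a" "incseq a" "a \<longlonglongrightarrow> frac x"
    and d: "crat d" "decseq d" "d \<longlonglongrightarrow> 0" "\<And>u. frac x - a u \<le> d u"
  shows False
proof -
  \<comment> \<open>As \<open>d\<close> is decreasing, looking at \<open>u - 1\<close> is enough to
    recognise the first such stage; \<open>u = 0\<close> is treated separately because there
    \<open>u - 1\<close> is again 0.\<close>
  define first where
    "first n u = (if d u \<le> (1/2) ^ n then if u = 0 then 1 else if d (u - 1) \<le> (1/2) ^ n then 0 else 1
      else 0 :: nat)" for n u
  define W where "W n u = real (first n u) * (2 * (1/2) ^ n)" for n u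
  have "computable (\<lambda>z. first (p1 z) (p2 z))"
    unfolding first_def
    by (intro computable_if_crat_le computable_if_eq crat_comp[OF d(1)] crat_half_power
        computable_diff computable_p1 computable_p2 computable_id computable_const)
  then have "crat (\<lambda>z. W (p1 z) (p2 z))"
    unfolding W_def
    by (intro crat_mult crat_nat crat_half_power crat_const computable_p1 computable_id) simp_all
  moreover have "(\<Sum>u<U. W n u) \<le> 2 * (1/2) ^ n" for n U
  proof -
    have "(\<Sum>u<U. first n u) = (if U = 0 then 0 else if d (U - 1) \<le> (1/2) ^ n then 1 else 0)"
    proof (induction U)
      case (Suc U)
      have "d U \<le> d (U - 1)" using d(2) by (simp add: decseqD)
      with Suc show ?case by (auto simp: first_def)
    qed simp
    then have "(\<Sum>u<U. real (first n u)) \<le> 1"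
      by (simp flip: of_nat_sum)
    then show ?thesis
      by (simp add: W_def flip: sum_distrib_right)
  qed
  ultimately obtain n where n: "\<And>u. queue a (W n) u \<le> frac x"
    using random_queue_bounded[OF assms(1) a, of W] by blast
  have "\<exists>u. d u \<le> (1/2) ^ n"
    using eventually_happens[OF order_tendstoD(2)[OF d(3), of "(1/2) ^ n"]]
    by (auto intro: less_imp_le)
  define u where "u = (LEAST u. d u \<le> (1/2) ^ n)"
  have u: "d u \<le> (1/2) ^ n" "\<And>v. v < u \<Longrightarrow> \<not> d v \<le> (1/2) ^ n"
    unfolding u_def using LeastI_ex[OF \<open>\<exists>u. d u \<le> (1/2) ^ n\<close>] not_less_Least by blast+
  then have "first n u = 1" by (auto simp: first_def)
  have "a u + W n u \<le> queue a (W n) (Suc u)"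
    using queue_ge[of "W n" u "Suc u" a] by (simp add: W_def)
  moreover have "frac x < a u + W n u"
  proof -
    have "W n u = 2 * (1/2) ^ n" "(0::real) < (1/2) ^ n"
      using \<open>first n u = 1\<close> by (simp_all add: W_def)
    then show ?thesis
      using d(4)[of u] u(1) by linarith
  qed
  ultimately show False
    using n[of "Suc u"] by linarith
qed

section \<open>Oscillating approximations\<close>

text \<open>\<open>low\<close> and \<open>high\<close> say that the approximations of
  \<open>p * A - B\<close> and \<open>q * A - B\<close> lie infinitely often on the wrong side of
  their limits. The bound \<open>A < 1\<close> lets the constant 1 serve as an initial cover end for
  \<open>A\<close>.\<close>

locale oscillation =
  fixes a b :: "nat \<Rightarrow> real" and A B p q :: real
  assumes a: "crat a" "incseq a" "a \<longlonglongrightarrow> A" "A < 1"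
    and b: "crat b" "incseq b" "b \<longlonglongrightarrow> B"
    and pq: "p \<in> \<rat>" "q \<in> \<rat>" "0 < p" "p < q"
    and low: "\<And>N. \<exists>t\<ge>N. p * a t - b t < p * A - B"
    and high: "\<And>N. \<exists>t\<ge>N. q * A - B < q * a t - b t"
begin

definition side :: "nat \<Rightarrow> nat \<Rightarrow> real" where
  "side m = (if even m then a else b)"

definition target :: "nat \<Rightarrow> real" where
  "target m = (if even m then A else B)"

definition ratio :: "nat \<Rightarrow> real" where
  "ratio m = (if even m then p else 1 / q)"

text \<open>Level \<open>m + 1\<close> converts the movement of one coordinate inside level \<open>m\<close> into a cover of
  the other coordinate. A late low point makes the cover of \<open>B\<close> at rate \<open>p\<close> succeed, a late high
  point that of \<open>A\<close> at rate \<open>1 / q\<close>, so two steps shrink the measure by \<open>p / q\<close>.\<close>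

primrec level :: "nat \<Rightarrow> nat \<Rightarrow> real" where
  "level 0 = (\<lambda>_. 1)"
| "level (Suc m) = queue (side (Suc m)) (\<lambda>u. ratio m * covered (side m) (level m) u)"

lemma side: "incseq (side m)" "side m \<longlonglongrightarrow> target m" "side m u \<le> target m"
  using a b incseq_le by (auto simp: side_def target_def)

lemma ratio_nonneg: "0 \<le> ratio m"
  using pq by (simp add: ratio_def)

lemma weight_nonneg: "0 \<le> ratio m * covered s E u"
  using ratio_nonneg covered_nonneg by simp

lemma computable_parity: "computable f \<Longrightarrow> computable (\<lambda>x. f x mod 2)"
proof -
  assume f: "computable f"
  have "rec_nat 0 (\<lambda>_ y. 1 - y) n = n mod 2" for n :: nat
    by (induction n) (auto simp: mod_Suc)
  then show ?thesis
    using computable_rec[where b = "\<lambda>_. 0" and h = "\<lambda>_ y _. 1 - y", OF _ _ f f]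
    by (simp add: computable_const computable_diff computable_p1 computable_p2 computable_id)
qed

lemma crat_side:
  assumes "computable f" "computable g" shows "crat (\<lambda>x. side (f x) (g x))"
proof -
  have "crat (\<lambda>x. if f x mod 2 = 0 then a (g x) else b (g x))"
    by (intro crat_if0 computable_parity crat_comp[OF a(1)] crat_comp[OF b(1)] assms)
  then show ?thesis
    by (simp add: side_def even_iff_mod_2_eq_zero if_distrib[of "\<lambda>h. h _"])
qed

lemma crat_ratio: "computable f \<Longrightarrow> crat (\<lambda>x. ratio (f x))"
proof -
  assume "computable f"
  then have "crat (\<lambda>x. if f x mod 2 = 0 then p else 1 / q)"
    using pq by (intro crat_if0 computable_parity crat_const) auto
  then show ?thesis
    by (simp add: ratio_def even_iff_mod_2_eq_zero)
qed

lemma crat_covered: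
  assumes "computable m" "computable u" "crat e"
  shows "crat (\<lambda>x. max 0 (min (side (m x) (Suc (u x))) (e x) - side (m x) (u x)))"
  by (intro crat_monus crat_min crat_side computable_Suc assms)

lemma crat_level:
  assumes "computable m" "computable u"
  shows "crat (\<lambda>x. level (m x) (u x))"
proof (rule crat_levels[OF _ _ _ assms])
  \<comment> \<open>Both clauses of \<open>level\<close> are merged into the shape required by
    \<open>crat_levels\<close>; the branch \<open>m = 0\<close> shields against the truncated
    \<open>m - 1\<close>.\<close>
  show "level m (Suc u) = (\<lambda>m u y z. if m = 0 then 1 else max y (side m (Suc u))
      + ratio (m - 1) * max 0 (min (side (m - 1) (Suc u)) z - side (m - 1) u))
      m u (level m u) (level (m - 1) u)" for m u
    by (cases m) (simp_all add: covered_def)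
  show "crat (\<lambda>z. if p1 z = 0 then 1 else max (dec (p1 (p2 (p2 z)))) (side (p1 z) (Suc (p1 (p2 z))))
      + ratio (p1 z - 1) * max 0 (min (side (p1 z - 1) (Suc (p1 (p2 z)))) (dec (p2 (p2 (p2 z))))
        - side (p1 z - 1) (p1 (p2 z))))"
    by (intro crat_if0 crat_add crat_max crat_mult crat_dec crat_covered crat_side crat_ratio
        crat_const computable_p1 computable_p2 computable_id computable_Suc computable_diff
        computable_const) simp_all
  have "crat (\<lambda>m. if m = 0 then 1 else side m 0)"
    by (intro crat_if0 crat_const crat_side computable_id computable_const) simp_all
  moreover have "level m 0 = (if m = 0 then 1 else side m 0)" for m
    by (cases m) simp_all
  ultimately show "crat (\<lambda>m. level m 0)" by simp
qed

lemma mono_level: "mono (level m)"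
proof (cases m)
  case (Suc k)
  show ?thesis unfolding Suc level.simps by (intro mono_queue weight_nonneg)
qed (simp add: mono_def)

text \<open>For even \<open>m\<close> this is \<open>low\<close> rearranged, for odd
  \<open>m\<close> it is \<open>high\<close> divided by \<open>q\<close>: at stage \<open>t\<close>
  the scaled remaining movement of one side exceeds the remaining distance of the other.\<close>

lemma late_point: "\<exists>t\<ge>N. target (Suc m) < side (Suc m) t + ratio m * (target m - side m t)"
proof (cases "even m")
  case True
  with low[of N] show ?thesis
    by (auto simp: target_def side_def ratio_def algebra_simps)
next
  case False
  obtain t where "t \<ge> N" "q * A - B < q * a t - b t"
    using high by blast
  then have "t \<ge> N \<and> A < a t + (B - b t) / q"
    using pq by (simp add: field_simps)
  with False show ?thesis
    by (auto simp: target_def side_def ratio_def)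
qed

text \<open>Once level \<open>m\<close> has passed its target, all later movement of
  \<open>side m\<close> is covered and feeds level \<open>m + 1\<close> in full. Counted from a late
  point, this total carries level \<open>m + 1\<close> past its own target, and by convergence a
  finite stage suffices.\<close>

lemma level_exceeds: "\<exists>u. target m < level m u"
proof (induction m)
  case 0
  show ?case using a(4) by (simp add: target_def)
next
  case (Suc m)
  then obtain N where N: "target m < level m N" by blast
  have covered: "covered (side m) (level m) u = side m (Suc u) - side m u" if "N \<le> u" for u
    using monoD[OF mono_level that, of m] N side(3)[of m "Suc u"] incseq_SucD[OF side(1)[of m], of u]
    by (simp add: covered_def)
  obtain t where t: "N \<le> t" "target (Suc m) < side (Suc m) t + ratio m * (target m - side m t)"
    using late_point by blast
  have "(\<lambda>u. side (Suc m) t + ratio m * (side m u - side m t))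
      \<longlonglongrightarrow> side (Suc m) t + ratio m * (target m - side m t)"
    by (intro tendsto_intros side)
  then have "eventually (\<lambda>u. target (Suc m) < side (Suc m) t + ratio m * (side m u - side m t))
      sequentially"
    using t(2) by (rule order_tendstoD)
  with eventually_ge_at_top[of t] have "eventually (\<lambda>u. t \<le> u \<and>
      target (Suc m) < side (Suc m) t + ratio m * (side m u - side m t)) sequentially"
    by (rule eventually_conj)
  then obtain u where u: "t \<le> u"
      "target (Suc m) < side (Suc m) t + ratio m * (side m u - side m t)"
    using eventually_happens[of _ sequentially] by auto
  have "side (Suc m) t + (\<Sum>v=t..<u. ratio m * covered (side m) (level m) v) \<le> level (Suc m) u"
    using queue_ge[OF weight_nonneg u(1)] by simp
  also have "(\<Sum>v=t..<u. ratio m * covered (side m) (level m) v) = ratio m * (side m u - side m t)"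
    using t(1) u(1) by (simp add: covered sum_Suc_diff' flip: sum_distrib_left)
  finally show ?case using u(2) by (intro exI[of _ u]) simp
qed

lemma sum_covered_Suc:
  "(\<Sum>u<U. covered (side (Suc m)) (level (Suc m)) u)
    \<le> ratio m * (\<Sum>u<U. covered (side m) (level m) u)"
  using sum_covered_queue[OF side(1) weight_nonneg] by (simp add: sum_distrib_left)

text \<open>At level 0 at most the whole movement \<open>A - a 0\<close> is covered. Two successive
  levels multiply the measure by \<open>p\<close> and then by \<open>1 / q\<close>.\<close>

lemma sum_covered_even: "(\<Sum>u<U. covered (side (2 * n)) (level (2 * n)) u) \<le> (p / q) ^ n"
proof (induction n)
  case 0
  have "covered (side 0) (level 0) u \<le> a (Suc u) - a u" for u
    using incseq_SucD[OF a(2), of u] by (simp add: covered_def side_def)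
  then have "(\<Sum>u<U. covered (side 0) (level 0) u) \<le> (\<Sum>u<U. a (Suc u) - a u)"
    by (rule sum_mono)
  also have "\<dots> \<le> A - a 0" using sum_diff_le_limit a by blast
  also have "\<dots> \<le> 1" using a(4) crat_nonneg[OF a(1), of 0] by simp
  finally show ?case by simp
next
  case (Suc n)
  let ?S = "\<lambda>m. \<Sum>u<U. covered (side m) (level m) u"
  have "?S (2 * Suc n) \<le> 1 / q * ?S (Suc (2 * n))"
    using sum_covered_Suc[where U = U and m = "Suc (2 * n)"] by (simp add: ratio_def del: level.simps)
  also have "\<dots> \<le> 1 / q * (p * ?S (2 * n))"
    using sum_covered_Suc[where U = U and m = "2 * n"] pq by (intro mult_left_mono) (simp_all add: ratio_def del: level.simps)
  also have "\<dots> = p / q * ?S (2 * n)" by simp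
  also have "\<dots> \<le> p / q * (p / q) ^ n"
    using pq by (intro mult_left_mono[OF Suc]) simp
  finally show ?case by simp
qed

lemma not_random:
  assumes "A = frac x" shows "\<not> mloef_random x"
proof
  assume x: "mloef_random x"
  \<comment> \<open>\<open>k\<close> double steps at least halve the measure, so test level
    \<open>n\<close> needs \<open>k * n\<close> of them.\<close>
  obtain k where k: "(p / q) ^ k < 1/2"
    using real_arch_pow_inv[of "1/2" "p / q"] pq by auto
  \<comment> \<open>\<open>M n\<close> is odd, so the next level is a queue over \<open>a\<close>;
    the extra double step only contributes another factor \<open>p / q\<close>, which is below
    1.\<close>
  define M where "M n = Suc (2 * (k * n))" for n
  define W where "W n u = 1 / q * covered (side (M n)) (level (M n)) u" for n u
  have level: "level (Suc (M n)) = queue a (W n)" for n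
    unfolding W_def by (simp add: M_def side_def ratio_def)
  have "computable (\<lambda>z. M (p1 z))"
    unfolding M_def
    by (intro computable_Suc computable_mult computable_const computable_p1 computable_id)
  then have "crat (\<lambda>z. W (p1 z) (p2 z))"
    unfolding W_def covered_def using pq
    by (intro crat_mult crat_const crat_covered crat_level computable_p2 computable_id) simp_all
  moreover have "(\<Sum>u<U. W n u) \<le> 1 * (1/2) ^ n" for n U
  proof -
    have "(\<Sum>u<U. W n u) \<le> 1 / q * (p * (\<Sum>u<U. covered (side (2 * (k * n))) (level (2 * (k * n))) u))"
      using sum_covered_Suc[where U = U and m = "2 * (k * n)"] pq unfolding W_def M_def sum_distrib_left[symmetric]
      by (intro mult_left_mono) (simp_all add: ratio_def del: level.simps)
    also have "\<dots> \<le> 1 / q * (p * (p / q) ^ (k * n))"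
      using pq by (intro mult_left_mono sum_covered_even) simp_all
    also have "\<dots> = p / q * ((p / q) ^ k) ^ n" by (simp add: power_mult)
    also have "\<dots> \<le> 1 * (1/2) ^ n"
      using pq k by (intro mult_mono power_mono) simp_all
    finally show ?thesis .
  qed
  ultimately obtain n where "\<And>u. queue a (W n) u \<le> frac x"
    using random_queue_bounded[OF x a(1,2), of W] a(3) assms by blast
  moreover have "target (Suc (M n)) = A"
    by (simp add: target_def M_def)
  ultimately show False
    using level_exceeds[of "Suc (M n)"] assms by (auto simp: level simp del: level.simps dest: leD)
qed

end

section \<open>Left-c.e. and right-c.e. reals\<close>

text \<open>Signed rational sequences are kept as differences of two nonnegative ones, so that the
  \<open>crat\<close> closure rules remain usable.\<close>

definition csig :: "(nat \<Rightarrow> real) \<Rightarrow> bool" where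
  "csig f \<longleftrightarrow> (\<exists>g h. crat g \<and> crat h \<and> (\<forall>n. f n = g n - h n))"

lemma csigI: "crat g \<Longrightarrow> crat h \<Longrightarrow> (\<And>n. f n = g n - h n) \<Longrightarrow> csig f"
  unfolding csig_def by blast

lemma csig_iff_computable_rat_seq:
  "csig f \<longleftrightarrow> (\<exists>q. computable_rat_seq q \<and> f = (\<lambda>n. real_of_rat (q n)))"
proof
  assume "csig f"
  then obtain g h where gh: "crat g" "crat h" "\<And>n. f n = g n - h n"
    unfolding csig_def by blast
  obtain a b d where *: "computable a" "computable b" "computable d" "\<And>x. 0 < d x"
    "\<And>x. g x = real (a x) / real (d x)" "\<And>x. h x = real (b x) / real (d x)"
    using crat_common[OF gh(1,2)] by metis
  define q :: "nat \<Rightarrow> rat" where "q n = (of_nat (a n) - of_nat (b n)) / of_nat (d n)" for n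
  have "computable_rat_seq q"
    unfolding computable_rat_seq_def q_def using * by blast
  moreover have "f n = real_of_rat (q n)" for n
    by (simp add: q_def gh(3) * of_rat_divide of_rat_diff diff_divide_distrib)
  ultimately show "\<exists>q. computable_rat_seq q \<and> f = (\<lambda>n. real_of_rat (q n))" by blast
next
  assume "\<exists>q. computable_rat_seq q \<and> f = (\<lambda>n. real_of_rat (q n))"
  then obtain q a b c where "computable a" "computable b" "computable c"
    "\<And>n. q n = (of_nat (a n) - of_nat (b n)) / of_nat (c n)" "f = (\<lambda>n. real_of_rat (q n))"
    unfolding computable_rat_seq_def by blast
  then show "csig f"
    \<comment> \<open>Zero denominators are allowed in \<open>computable_rat_seq\<close>; both sides
      then evaluate to 0.\<close>
    by (intro csigI[of "\<lambda>n. real (a n) / real (c n)" "\<lambda>n. real (b n) / real (c n)"] crat_divide_nat)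
      (simp_all add: of_rat_divide of_rat_diff diff_divide_distrib)
qed

lemma left_ce_iff: "left_ce x \<longleftrightarrow> (\<exists>f. csig f \<and> incseq f \<and> f \<longlonglongrightarrow> x)"
  unfolding left_ce_def csig_iff_computable_rat_seq by blast

lemma right_ce_iff: "right_ce x \<longleftrightarrow> (\<exists>f. csig f \<and> decseq f \<and> f \<longlonglongrightarrow> x)"
  unfolding right_ce_def csig_iff_computable_rat_seq by blast

lemma csig_crat: "crat f \<Longrightarrow> csig f"
  by (rule csigI[of f "\<lambda>_. 0"]) (simp_all add: crat_const)

lemma csig_const:
  assumes "r \<in> \<rat>" shows "csig (\<lambda>_. r)"
  by (rule csigI[of "\<lambda>_. max 0 r" "\<lambda>_. max 0 (- r)"]) (use assms in \<open>auto intro!: crat_const simp: max_def\<close>)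

lemma csig_add: "csig f \<Longrightarrow> csig g \<Longrightarrow> csig (\<lambda>n. f n + g n)"
proof -
  assume "csig f" "csig g"
  then obtain f1 f2 g1 g2 where "crat f1" "crat f2" "crat g1" "crat g2"
    "\<And>n. f n = f1 n - f2 n" "\<And>n. g n = g1 n - g2 n"
    unfolding csig_def by blast
  then show ?thesis
    by (intro csigI[of "\<lambda>n. f1 n + g1 n" "\<lambda>n. f2 n + g2 n"] crat_add) simp_all
qed

lemma csig_minus: "csig f \<Longrightarrow> csig (\<lambda>n. - f n)"
  unfolding csig_def by (metis minus_diff_eq)

lemma csig_diff: "csig f \<Longrightarrow> csig g \<Longrightarrow> csig (\<lambda>n. f n - g n)"
  using csig_add[OF _ csig_minus] by simp

lemma csig_cmult:
  assumes "csig f" "r \<in> \<rat>" "0 \<le> r" shows "csig (\<lambda>n. r * f n)"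
proof -
  obtain g h where "crat g" "crat h" "\<And>n. f n = g n - h n"
    using assms(1) unfolding csig_def by blast
  with assms show ?thesis
    by (intro csigI[of "\<lambda>n. r * g n" "\<lambda>n. r * h n"] crat_mult crat_const)
      (simp_all add: right_diff_distrib)
qed

lemma crat_pos_part: "csig f \<Longrightarrow> crat (\<lambda>n. max 0 (f n))"
  unfolding csig_def using crat_monus by fastforce

lemma crat_csig_nonneg: "csig f \<Longrightarrow> (\<And>n. 0 \<le> f n) \<Longrightarrow> crat f"
  using crat_pos_part[of f] by (simp add: max_def)

text \<open>The integer part is a rational constant and can be subtracted; clipping at 0 makes the
  sequence nonnegative and keeps the limit, since \<open>frac x\<close> is nonnegative.\<close>

lemma left_ce_frac:
  assumes "left_ce x"
  obtains a where "crat a" "incseq a" "a \<longlonglongrightarrow> frac x"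
proof -
  obtain f where f: "csig f" "incseq f" "f \<longlonglongrightarrow> x"
    using assms unfolding left_ce_iff by blast
  show thesis
  proof (rule that)
    show "crat (\<lambda>n. max 0 (f n - of_int \<lfloor>x\<rfloor>))"
      by (intro crat_pos_part csig_diff csig_const f Rats_of_int)
    show "incseq (\<lambda>n. max 0 (f n - of_int \<lfloor>x\<rfloor>))"
    proof (rule incseq_SucI)
      fix n
      show "max 0 (f n - of_int \<lfloor>x\<rfloor>) \<le> max 0 (f (Suc n) - of_int \<lfloor>x\<rfloor>)"
        using incseq_SucD[OF f(2), of n] by (intro max.mono) simp_all
    qed
    have "(\<lambda>n. max 0 (f n - of_int \<lfloor>x\<rfloor>)) \<longlonglongrightarrow> max 0 (x - of_int \<lfloor>x\<rfloor>)"
      by (intro tendsto_intros f)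
    then show "(\<lambda>n. max 0 (f n - of_int \<lfloor>x\<rfloor>)) \<longlonglongrightarrow> frac x"
      by (simp add: frac_def)
  qed
qed

section \<open>Monotone approximations of differences by running maxima and minima\<close>

primrec running :: "(real \<Rightarrow> real \<Rightarrow> real) \<Rightarrow> (nat \<Rightarrow> real) \<Rightarrow> nat \<Rightarrow> real" where
  "running h f 0 = f 0"
| "running h f (Suc n) = h (running h f n) (f (Suc n))"

lemma crat_running:
  assumes "crat f" "\<And>f g. crat f \<Longrightarrow> crat g \<Longrightarrow> crat (\<lambda>x. h (f x) (g x))"
  shows "crat (running h f)"
proof -
  have "running h f n = rec_nat (f 0) (\<lambda>i y. h y (f (Suc i))) n" for n
    by (induction n) auto
  then have "running h f = (\<lambda>n. rec_nat (f 0) (\<lambda>i y. h y (f (Suc i))) n)"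
    by blast
  moreover have "crat (\<lambda>n. rec_nat (f 0) (\<lambda>i y. h y (f (Suc i))) n)"
    by (rule crat_rec[where B = "\<lambda>_. f 0" and H = "\<lambda>i y _. h y (f (Suc i))", OF _ _ computable_id
          computable_id])
      (intro assms(2) crat_comp[OF assms(1)] crat_dec computable_const computable_Suc computable_p1
        computable_p2 computable_id)+
  ultimately show ?thesis by simp
qed

lemma crat_shifted_difference:
  assumes "crat a" "crat b" "\<And>n. b n \<le> 1" "r \<in> \<rat>" "0 \<le> r"
  shows "crat (\<lambda>n. r * a (n + N) - b (n + N) + 1)"
proof -
  have "crat (\<lambda>n. (r * a (n + N) + 1) - b (n + N))"
  proof (intro crat_diff crat_add crat_mult crat_const crat_comp[OF assms(1)] crat_comp[OF assms(2)]
      computable_add computable_id computable_const assms)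
    show "b (n + N) \<le> r * a (n + N) + 1" for n
      using assms(3)[of "n + N"] crat_nonneg[OF assms(1), of "n + N"] assms(5) by (simp add: add_increasing)
  qed simp_all
  then show ?thesis by (simp add: algebra_simps)
qed

context
  fixes \<alpha> \<beta> r :: real and a b :: "nat \<Rightarrow> real" and N :: nat
  assumes a: "crat a" "a \<longlonglongrightarrow> frac \<alpha>" and b: "crat b" "incseq b" "b \<longlonglongrightarrow> frac \<beta>"
    and r: "r \<in> \<rat>" "0 \<le> r"
begin

text \<open>The shift by \<open>N\<close> discards the stages where the one-sided bound may fail.
  Adding 1 keeps the values nonnegative, as \<open>b\<close> stays below 1.\<close>

definition shifted :: "nat \<Rightarrow> real" where
  "shifted n = r * a (n + N) - b (n + N) + 1"

lemma crat_shifted: "crat shifted"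
  unfolding shifted_def
proof (intro crat_shifted_difference a b r)
  show "b n \<le> 1" for n
    using incseq_le[OF b(2,3), of n] frac_lt_1[of \<beta>] by linarith
qed

lemma shifted_limit: "shifted \<longlonglongrightarrow> r * frac \<alpha> - frac \<beta> + 1"
  unfolding shifted_def by (intro tendsto_intros LIMSEQ_ignore_initial_segment a b)

text \<open>The running maximum is increasing and is squeezed between the sequence and its limit.
  The right-c.e. case is dual, with the running minimum.\<close>

lemma left_ce_difference:
  assumes "\<And>t. N \<le> t \<Longrightarrow> r * a t - b t \<le> r * frac \<alpha> - frac \<beta>"
  shows "left_ce (r * \<alpha> - \<beta>)"
proof -
  \<comment> \<open>\<open>c\<close> puts the integer parts back and removes the added 1.\<close>
  define c where "c = r * of_int \<lfloor>\<alpha>\<rfloor> - of_int \<lfloor>\<beta>\<rfloor> - 1"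
  have "shifted n \<le> r * frac \<alpha> - frac \<beta> + 1" for n
    using assms[of "n + N"] by (simp add: shifted_def)
  then have "running max shifted n \<le> r * frac \<alpha> - frac \<beta> + 1" for n
    by (induction n) auto
  moreover have "shifted n \<le> running max shifted n" for n
    by (cases n) auto
  ultimately have "running max shifted \<longlonglongrightarrow> r * frac \<alpha> - frac \<beta> + 1"
    by (intro tendsto_sandwich[OF _ _ shifted_limit tendsto_const]) auto
  then have "(\<lambda>n. running max shifted n + c) \<longlonglongrightarrow> r * frac \<alpha> - frac \<beta> + 1 + c"
    by (intro tendsto_intros)
  also have "r * frac \<alpha> - frac \<beta> + 1 + c = r * \<alpha> - \<beta>"
    by (simp add: c_def frac_def algebra_simps)
  finally have "(\<lambda>n. running max shifted n + c) \<longlonglongrightarrow> r * \<alpha> - \<beta>" .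
  moreover have "csig (\<lambda>n. running max shifted n + c)"
    unfolding c_def using r
    by (intro csig_add csig_crat[OF crat_running[OF crat_shifted crat_max]] csig_const) simp_all
  moreover have "incseq (\<lambda>n. running max shifted n + c)"
    by (intro incseq_SucI) simp
  ultimately show ?thesis
    unfolding left_ce_iff by blast
qed

lemma right_ce_difference:
  assumes "\<And>t. N \<le> t \<Longrightarrow> r * frac \<alpha> - frac \<beta> \<le> r * a t - b t"
  shows "right_ce (r * \<alpha> - \<beta>)"
proof -
  define c where "c = r * of_int \<lfloor>\<alpha>\<rfloor> - of_int \<lfloor>\<beta>\<rfloor> - 1"
  have "r * frac \<alpha> - frac \<beta> + 1 \<le> shifted n" for n
    using assms[of "n + N"] by (simp add: shifted_def)
  then have "r * frac \<alpha> - frac \<beta> + 1 \<le> running min shifted n" for n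
    by (induction n) auto
  moreover have "running min shifted n \<le> shifted n" for n
    by (cases n) auto
  ultimately have "running min shifted \<longlonglongrightarrow> r * frac \<alpha> - frac \<beta> + 1"
    by (intro tendsto_sandwich[OF _ _ tendsto_const shifted_limit]) auto
  then have "(\<lambda>n. running min shifted n + c) \<longlonglongrightarrow> r * frac \<alpha> - frac \<beta> + 1 + c"
    by (intro tendsto_intros)
  also have "r * frac \<alpha> - frac \<beta> + 1 + c = r * \<alpha> - \<beta>"
    by (simp add: c_def frac_def algebra_simps)
  finally have "(\<lambda>n. running min shifted n + c) \<longlonglongrightarrow> r * \<alpha> - \<beta>" .
  moreover have "csig (\<lambda>n. running min shifted n + c)"
    unfolding c_def using r
    by (intro csig_add csig_crat[OF crat_running[OF crat_shifted crat_min]] csig_const) simp_all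
  moreover have "decseq (\<lambda>n. running min shifted n + c)"
    by (intro decseq_SucI) simp
  ultimately show ?thesis
    unfolding right_ce_iff by blast
qed

end

section \<open>Comparison of the two kinds of multipliers\<close>

text \<open>If \<open>r < s\<close>, the difference of the two given reals is
  \<open>(s - r) * \<alpha>\<close>, which thereby gets a decreasing approximation. Together with
  the increasing one of \<alpha> this yields a computable error bound, contradicting
  \<open>random_not_computable\<close>.\<close>

lemma right_ce_le_left_ce:
  assumes \<alpha>: "left_ce \<alpha>" "mloef_random \<alpha>" and rat: "r \<in> \<rat>" "s \<in> \<rat>"
    and left: "left_ce (r * \<alpha> - \<beta>)" and right: "right_ce (s * \<alpha> - \<beta>)"
  shows "s \<le> r"
proof (rule ccontr)
  assume "\<not> s \<le> r"
  then have rs: "0 < s - r" by simp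
  obtain a where a: "crat a" "incseq a" "a \<longlonglongrightarrow> frac \<alpha>"
    using left_ce_frac[OF \<alpha>(1)] .
  obtain x where x: "csig x" "incseq x" "x \<longlonglongrightarrow> r * \<alpha> - \<beta>"
    using left unfolding left_ce_iff by blast
  obtain y where y: "csig y" "decseq y" "y \<longlonglongrightarrow> s * \<alpha> - \<beta>"
    using right unfolding right_ce_iff by blast
  \<comment> \<open>Upper approximation of \<alpha>, obtained from \<open>y u - x u\<close>, minus
    the lower approximation by \<open>a u\<close> and the integer part; it decreases to 0.\<close>
  define d where "d u = 1 / (s - r) * (y u - x u) - of_int \<lfloor>\<alpha>\<rfloor> - a u" for u
  have "csig d"
    unfolding d_def using rs rat
    by (intro csig_diff csig_cmult csig_const csig_crat x y a) auto
  have dec: "decseq d"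
  proof (rule decseq_SucI)
    fix u
    have "1 / (s - r) * (y (Suc u) - x (Suc u)) \<le> 1 / (s - r) * (y u - x u)"
      using rs incseq_SucD[OF x(2), of u] decseqD[OF y(2), of u "Suc u"]
      by (intro mult_left_mono) auto
    then show "d (Suc u) \<le> d u"
      using incseq_SucD[OF a(2), of u] by (simp add: d_def)
  qed
  have "d \<longlonglongrightarrow> 1 / (s - r) * ((s * \<alpha> - \<beta>) - (r * \<alpha> - \<beta>)) - of_int \<lfloor>\<alpha>\<rfloor> - frac \<alpha>"
    unfolding d_def by (intro tendsto_intros x y a)
  also have "(s * \<alpha> - \<beta>) - (r * \<alpha> - \<beta>) = (s - r) * \<alpha>"
    by (simp add: algebra_simps)
  also have "1 / (s - r) * ((s - r) * \<alpha>) - of_int \<lfloor>\<alpha>\<rfloor> - frac \<alpha> = 0"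
    using rs by (simp add: frac_def)
  finally have lim: "d \<longlonglongrightarrow> 0" .
  have "0 \<le> d u" for u
    using decseq_ge[OF dec lim] .
  with \<open>csig d\<close> have "crat d"
    by (rule crat_csig_nonneg)
  moreover have "frac \<alpha> - a u \<le> d u" for u
  proof -
    have "(s - r) * \<alpha> \<le> y u - x u"
      using decseq_ge[OF y(2,3), of u] incseq_le[OF x(2,3), of u] by (simp add: algebra_simps)
    then have "\<alpha> \<le> 1 / (s - r) * (y u - x u)"
      using rs by (simp add: field_simps)
    then show ?thesis by (simp add: d_def frac_def)
  qed
  ultimately show False
    using random_not_computable[OF \<alpha>(2) a _ dec lim] by blast
qed

text \<open>If both fail, then for every \<open>N\<close> the one-sided bounds in
  \<open>right_ce_difference\<close> and \<open>left_ce_difference\<close> are violated after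
  \<open>N\<close>, which is exactly an \<open>oscillation\<close>.\<close>

lemma right_ce_or_left_ce:
  assumes "left_ce \<alpha>" "left_ce \<beta>" "mloef_random \<alpha>" and pq: "p \<in> \<rat>" "q \<in> \<rat>" "0 < p" "p < q"
  shows "right_ce (p * \<alpha> - \<beta>) \<or> left_ce (q * \<alpha> - \<beta>)"
proof (rule ccontr)
  assume neither: "\<not> ?thesis"
  obtain a where a: "crat a" "incseq a" "a \<longlonglongrightarrow> frac \<alpha>"
    using left_ce_frac[OF assms(1)] .
  obtain b where b: "crat b" "incseq b" "b \<longlonglongrightarrow> frac \<beta>"
    using left_ce_frac[OF assms(2)] .
  have "\<exists>t\<ge>N. p * a t - b t < p * frac \<alpha> - frac \<beta>" for N
    using right_ce_difference[OF a(1,3) b pq(1), of N] pq neither by (meson less_imp_le not_le)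
  moreover have "\<exists>t\<ge>N. q * frac \<alpha> - frac \<beta> < q * a t - b t" for N
    using left_ce_difference[OF a(1,3) b pq(2), of N] pq neither by (meson less_imp_le less_trans not_le)
  ultimately have "oscillation a b (frac \<alpha>) (frac \<beta>) p q"
    using a b pq by unfold_locales (auto simp: frac_lt_1)
  then show False
    using oscillation.not_random assms(3) by blast
qed

text \<open>This makes \<open>D_low\<close> positive, so that every real above it is a positive
  multiplier. The witness is the power of \<open>1/2\<close> from \<open>random_dominates\<close>,
  used with randomness of \<beta>.\<close>

lemma ex_right_ce:
  assumes "left_ce \<alpha>" "left_ce \<beta>" "mloef_random \<beta>"
  obtains r where "r \<in> \<rat>" "0 < r" "right_ce (r * \<alpha> - \<beta>)"
proof -
  obtain a where a: "crat a" "incseq a" "a \<longlonglongrightarrow> frac \<alpha>"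
    using left_ce_frac[OF assms(1)] .
  obtain b where b: "crat b" "incseq b" "b \<longlonglongrightarrow> frac \<beta>"
    using left_ce_frac[OF assms(2)] .
  obtain n where n: "\<And>t. b t - (1/2) ^ n * a t \<le> frac \<beta> - (1/2) ^ n * frac \<alpha>"
    using random_dominates[OF assms(3) b a] by blast
  have "right_ce ((1/2) ^ n * \<alpha> - \<beta>)"
    using right_ce_difference[OF a(1,3) b, of "(1/2) ^ n" 0] n by (simp add: algebra_simps)
  then show thesis
    by (intro that[of "(1/2) ^ n"]) simp_all
qed

theorem theorem1p5:
  fixes \<alpha> \<beta> :: real
  assumes "left_ce \<alpha>" and "left_ce \<beta>"
    and "mloef_random \<alpha>" and "mloef_random \<beta>"
  shows "D_up \<alpha> \<beta> = D_low \<alpha> \<beta>"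
proof (rule antisym)
  have up: "D_up \<alpha> \<beta> \<le> ereal q" if "q \<in> \<rat>" "0 < q" "left_ce (q * \<alpha> - \<beta>)" for q
    using that unfolding D_up_def by (auto elim!: Rats_cases intro!: INF_lower)
  have low: "ereal p \<le> D_low \<alpha> \<beta>" if "p \<in> \<rat>" "0 < p" "right_ce (p * \<alpha> - \<beta>)" for p
    using that unfolding D_low_def by (auto elim!: Rats_cases intro!: SUP_upper)
  show "D_low \<alpha> \<beta> \<le> D_up \<alpha> \<beta>"
    unfolding D_low_def D_up_def
    by (intro SUP_least INF_greatest)
      (use right_ce_le_left_ce[OF assms(1,3) Rats_of_rat Rats_of_rat] in auto)
  show "D_up \<alpha> \<beta> \<le> D_low \<alpha> \<beta>"
  proof (rule ccontr)
    assume "\<not> D_up \<alpha> \<beta> \<le> D_low \<alpha> \<beta>"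
    \<comment> \<open>A gap contains finite reals \<open>x < y\<close> even if an end is infinite.
      Rationals \<open>p < q\<close> chosen between them lie strictly above \<open>D_low\<close> and
      below \<open>D_up\<close>, so \<open>p\<close> is not a right-c.e. multiplier and
      \<open>q\<close> not a left-c.e. one.\<close>
    then obtain y where y: "D_low \<alpha> \<beta> < ereal y" "ereal y < D_up \<alpha> \<beta>"
      by (auto simp: not_le dest: ereal_dense2)
    then obtain x where x: "D_low \<alpha> \<beta> < ereal x" "x < y"
      using ereal_dense2[of "D_low \<alpha> \<beta>" "ereal y"] by auto
    obtain q where q: "q \<in> \<rat>" "x < q" "q < y"
      using Rats_dense_in_real[OF x(2)] by blast
    obtain p where p: "p \<in> \<rat>" "x < p" "p < q"
      using Rats_dense_in_real[OF q(2)] by blast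
    obtain r where r: "0 < r" "ereal r \<le> D_low \<alpha> \<beta>"
      using ex_right_ce[OF assms(1,2,4)] low by metis
    have "0 < p"
      using r x(1) p(2) by (metis ereal_less_eq(3) less_le_trans not_less order.strict_trans)
    moreover have "\<not> right_ce (p * \<alpha> - \<beta>)"
      using low[OF p(1) \<open>0 < p\<close>] x(1) p(2) by (metis ereal_less(2) ereal_less_eq(3) leD less_imp_le order_trans)
    moreover have "\<not> left_ce (q * \<alpha> - \<beta>)"
      using up[OF q(1)] \<open>0 < p\<close> p(3) y(2) q(3) by (metis ereal_less_eq(3) leD less_imp_le less_trans order_trans)
    ultimately show False
      using right_ce_or_left_ce[OF assms(1-3) p(1) q(1) _ p(3)] by blast
  qed
qed

end
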